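(* Let $G$ be an Eulerian graph of genus $g$ with $m$ edges, $T$ a spanning tree of $G$, and $\mathfrak o$ an Eulerian orientation of $G$. For each integer $t\ge3$, $$\operatorname{ec}(G,\mathfrak o)=\frac{1}{m\cdot t^g}\sum_{\gamma\in M_t(\mathbf E_{\mathfrak o}^c(T))}\epsilon_t^{-\sigma(\gamma)}\operatorname{trace}\left(W_{1,\gamma}^m\right)=\frac{1}{m\cdot t^g}\sum_{\gamma\in M_t(\mathbf E_{\mathfrak o}^c(T))}\epsilon_t^{-\sigma(\gamma)}\operatorname{trace}\left(A_\gamma^m\right),$$ where $\sigma(\gamma)=\sum_{\mathbf e\in\mathbf E_{\mathfrak o}^c(T)}c_{\mathbf e}$ for $\gamma=\sum_{\mathbf e\in\mathbf E^c_{\mathfrak o}(T)}c_{\mathbf e}\cdot\mathbf e$.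
   Context: A graph is connected and finite, loops and multiple edges allowed, vertices $v_1,\dots,v_n$, edges $e_1,\dots,e_m$, genus $g=m-n+1$. Each edge gives two mutually inverse oriented edges; $\mathbf e(0),\mathbf e(1)$ are initial/terminal vertices. An orientation $\mathfrak o$ picks a positively oriented $\mathbf e_k$ for each $e_k$; $\mathbf E_{\mathfrak o}(G)=\{\mathbf e_1,\dots,\mathbf e_m\}$, $\mathbf E(G)$ is all $2m$ oriented edges, $\mathbf E^c_{\mathfrak o}(T)$ the positively oriented edges not in $T$. $\mathfrak o$ is Eulerian if every vertex has equal in- and out-degree with respect to $\mathfrak o$. An Eulerian circuit is a closed walk (sequence of oriented edges, each starting where the previous ends, ending where it started) traversing each edge exactly once; $G$ is Eulerian if it has one. $\operatorname{ec}(G,\mathfrak o)$ is the number of Eulerian circuits all of whose oriented edges lie in $\mathbf E_{\mathfrak o}(G)$, counted up to cyclic rotation. $C_1(G,\mathbb Z/t\mathbb Z)$ is the free module on $\mathbf E_{\mathfrak o}(G)$ with $1\cdot\mathbf e^{-1}=-1\cdot\mathbf e$, $\langle\sum a_k\mathbf e_k,\sum b_k\mathbf e_k\rangle=\sum a_kb_k$; $M_t(\mathbf F)$ is the submodule of elements supported on $\mathbf F$. $\epsilon_t=\exp(2\pi i/t)$; $\chi_\gamma(\mathbf e)=\epsilon_t^{\langle\gamma,1\cdot\mathbf e\rangle}$. $A_\gamma$: $n\times n$ with $(i,j)$ entry $\sum\chi_\gamma(\mathbf e)$ over $\mathbf e\in\mathbf E(G)$ from $v_i$ to $v_j$. $\mathbf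 e$ feeds into $\mathbf e'$ if $\mathbf e'\ne\mathbf e^{-1}$ and $\mathbf e(1)=\mathbf e'(0)$; $W_{1,\gamma}$: $2m\times 2m$ indexed by $\mathbf E(G)$ with $(\mathbf e,\mathbf e')$ entry $\chi_\gamma(\mathbf e)$ if $\mathbf e$ feeds into $\mathbf e'$, else $0$. *)

theory Defs
  imports
    Complex_Main
    "Graph_Theory.Graph_Theory"
    "Jordan_Normal_Form.Matrix"
begin

text \<open>
  A connected finite graph with loops and multiple edges is given by its vertices
  \<open>verts G\<close> and its oriented edges \<open>arcs G\<close>, where \<open>tail G e\<close> and \<open>head G e\<close> are the
  initial and the terminal vertex of \<open>e\<close>, together with the fixed-point-free involution
  \<open>arev\<close> on \<open>arcs G\<close> that sends \<open>e\<close> to its inverse. A loop therefore also contributes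
  two distinct mutually inverse elements of \<open>arcs G\<close>.
\<close>

locale conn_multigraph = bidirected_digraph G arev + fin_digraph G
  for G :: "('v, 'e) pre_digraph" and arev :: "'e \<Rightarrow> 'e" +
  assumes connected_G: "Digraph_Component.connected G"

definition edge_of :: "('e \<Rightarrow> 'e) \<Rightarrow> 'e \<Rightarrow> 'e set" where
  "edge_of arev e = {e, arev e}"

definition edges :: "('v, 'e) pre_digraph \<Rightarrow> ('e \<Rightarrow> 'e) \<Rightarrow> 'e set set" where
  "edges G arev = edge_of arev ` arcs G"

definition genus :: "('v, 'e) pre_digraph \<Rightarrow> ('e \<Rightarrow> 'e) \<Rightarrow> int" where
  "genus G arev = int (card (edges G arev)) - int (card (verts G)) + 1"

text \<open>
  The library's \<open>spanning_tree\<close> forbids directed cycles only; in a symmetric digraph the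
  walk \<open>[e, arev e]\<close> is such a cycle. A cycle of the undirected graph is a library cycle
  that does not use an unoriented edge twice. A spanning tree is given by its set of edges.
\<close>

definition is_spanning_tree ::
  "('v, 'e) pre_digraph \<Rightarrow> ('e \<Rightarrow> 'e) \<Rightarrow> 'e set set \<Rightarrow> bool" where
  "is_spanning_tree G arev T \<longleftrightarrow>
     T \<subseteq> edges G arev \<and>
     Digraph_Component.connected (G\<lparr>arcs := \<Union>T\<rparr>) \<and>
     (\<nexists>p. pre_digraph.cycle (G\<lparr>arcs := \<Union>T\<rparr>) p \<and> distinct (map (edge_of arev) p))"

text \<open>An orientation is given by its set of positively oriented edges.\<close>

definition orientation ::
  "('v, 'e) pre_digraph \<Rightarrow> ('e \<Rightarrow> 'e) \<Rightarrow> 'e set \<Rightarrow> bool" where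
  "orientation G arev Eo \<longleftrightarrow>
     Eo \<subseteq> arcs G \<and> (\<forall>a \<in> edges G arev. \<exists>!e. e \<in> a \<and> e \<in> Eo)"

definition eulerian_orientation ::
  "('v, 'e) pre_digraph \<Rightarrow> ('e \<Rightarrow> 'e) \<Rightarrow> 'e set \<Rightarrow> bool" where
  "eulerian_orientation G arev Eo \<longleftrightarrow>
     orientation G arev Eo \<and>
     (\<forall>v \<in> verts G. card {e \<in> Eo. head G e = v} = card {e \<in> Eo. tail G e = v})"

text \<open>The oriented edges in \<open>Eo\<close> whose underlying edge is not in \<open>T\<close>.\<close>

definition off_tree :: "'e set \<Rightarrow> 'e set set \<Rightarrow> 'e set" where
  "off_tree Eo T = Eo - \<Union>T"

text \<open>
  The empty sequence of oriented edges has no starting point and is not a closed walk. In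
  particular the graph with one vertex and no edges is not Eulerian.
\<close>

definition closed_walk :: "('v, 'e) pre_digraph \<Rightarrow> 'e list \<Rightarrow> bool" where
  "closed_walk G p \<longleftrightarrow> p \<noteq> [] \<and> (\<exists>u. pre_digraph.awalk G u p u)"

definition eulerian_circuit ::
  "('v, 'e) pre_digraph \<Rightarrow> ('e \<Rightarrow> 'e) \<Rightarrow> 'e list \<Rightarrow> bool" where
  "eulerian_circuit G arev p \<longleftrightarrow>
     closed_walk G p \<and> (\<forall>a \<in> edges G arev. \<exists>!i. i < length p \<and> p ! i \<in> a)"

definition eulerian_graph :: "('v, 'e) pre_digraph \<Rightarrow> ('e \<Rightarrow> 'e) \<Rightarrow> bool" where
  "eulerian_graph G arev \<longleftrightarrow> (\<exists>p. eulerian_circuit G arev p)"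

definition oriented_circuits ::
  "('v, 'e) pre_digraph \<Rightarrow> ('e \<Rightarrow> 'e) \<Rightarrow> 'e set \<Rightarrow> 'e list set" where
  "oriented_circuits G arev Eo = {p. eulerian_circuit G arev p \<and> set p \<subseteq> Eo}"

definition ec :: "('v, 'e) pre_digraph \<Rightarrow> ('e \<Rightarrow> 'e) \<Rightarrow> 'e set \<Rightarrow> nat" where
  "ec G arev Eo =
     card (oriented_circuits G arev Eo // {(p, q). \<exists>k. q = rotate k p})"

text \<open>
  \<open>\<int>/t\<int>\<close> is represented by the residues \<open>{0..<t}\<close>. An element \<open>\<Sum> c\<^sub>e \<cdot> e\<close> of
  \<open>C\<^sub>1(G, \<int>/t\<int>)\<close>, the free module on \<open>Eo\<close>, is its coefficient function, extended by zero.
\<close>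

definition C1 :: "nat \<Rightarrow> 'e set \<Rightarrow> ('e \<Rightarrow> int) set" where
  "C1 t Eo = {c. (\<forall>e \<in> Eo. c e \<in> {0..<int t}) \<and> (\<forall>e. e \<notin> Eo \<longrightarrow> c e = 0)}"

text \<open>\<open>1 \<cdot> e\<close> for an arbitrary oriented edge, with \<open>1 \<cdot> e\<inverse> = -1 \<cdot> e\<close>.\<close>

definition unit_chain :: "nat \<Rightarrow> ('e \<Rightarrow> 'e) \<Rightarrow> 'e set \<Rightarrow> 'e \<Rightarrow> 'e \<Rightarrow> int" where
  "unit_chain t arev Eo e =
     (if e \<in> Eo then (\<lambda>x. if x = e then 1 mod int t else 0)
      else (\<lambda>x. if x = arev e then (- 1) mod int t else 0))"

definition pairing :: "nat \<Rightarrow> 'e set \<Rightarrow> ('e \<Rightarrow> int) \<Rightarrow> ('e \<Rightarrow> int) \<Rightarrow> int" where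
  "pairing t Eo a b = (\<Sum>e\<in>Eo. a e * b e) mod int t"

definition M :: "nat \<Rightarrow> 'e set \<Rightarrow> 'e set \<Rightarrow> ('e \<Rightarrow> int) set" where
  "M t Eo F = {c \<in> C1 t Eo. \<forall>e. e \<notin> F \<longrightarrow> c e = 0}"

text \<open>The sum of the coefficients of \<open>c\<close> on \<open>F\<close>, as an element of \<open>\<int>/t\<int>\<close>.\<close>

definition coeff_sum :: "nat \<Rightarrow> 'e set \<Rightarrow> ('e \<Rightarrow> int) \<Rightarrow> int" where
  "coeff_sum t F c = (\<Sum>e\<in>F. c e) mod int t"

definition root_eps :: "nat \<Rightarrow> complex" where
  "root_eps t = exp (2 * complex_of_real pi * \<i> / of_nat t)"

definition chi :: "nat \<Rightarrow> ('e \<Rightarrow> 'e) \<Rightarrow> 'e set \<Rightarrow> ('e \<Rightarrow> int) \<Rightarrow> 'e \<Rightarrow> complex" where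
  "chi t arev Eo c e = root_eps t powi (pairing t Eo c (unit_chain t arev Eo e))"

text \<open>
  The rows and columns are indexed by an enumeration \<open>vs\<close> of the vertices, respectively
  \<open>es\<close> of all oriented edges.
\<close>

definition adj_mat ::
  "('v, 'e) pre_digraph \<Rightarrow> ('e \<Rightarrow> 'e) \<Rightarrow> 'e set \<Rightarrow> 'v list \<Rightarrow> nat \<Rightarrow> ('e \<Rightarrow> int) \<Rightarrow> complex mat" where
  "adj_mat G arev Eo vs t c =
     mat (length vs) (length vs)
       (\<lambda>(i, j). \<Sum>e | e \<in> arcs G \<and> tail G e = vs ! i \<and> head G e = vs ! j. chi t arev Eo c e)"

definition feeds_into :: "('v, 'e) pre_digraph \<Rightarrow> ('e \<Rightarrow> 'e) \<Rightarrow> 'e \<Rightarrow> 'e \<Rightarrow> bool" where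
  "feeds_into G arev e e' \<longleftrightarrow> e' \<noteq> arev e \<and> head G e = tail G e'"

definition edge_adj_mat ::
  "('v, 'e) pre_digraph \<Rightarrow> ('e \<Rightarrow> 'e) \<Rightarrow> 'e set \<Rightarrow> 'e list \<Rightarrow> nat \<Rightarrow> ('e \<Rightarrow> int) \<Rightarrow> complex mat" where
  "edge_adj_mat G arev Eo es t c =
     mat (length es) (length es)
       (\<lambda>(i, j). if feeds_into G arev (es ! i) (es ! j) then chi t arev Eo c (es ! i) else 0)"

definition mat_trace :: "'a :: comm_monoid_add mat \<Rightarrow> 'a" where
  "mat_trace A = (\<Sum>i<dim_row A. A $$ (i, i))"

end

theory Submission
  imports Defs
begin

text \<open>
  The trace of the \<open>m\<close>-th power of either matrix is a sum over closed walks of length \<open>m\<close>, and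
  orthogonality of characters turns the sum over \<open>\<gamma>\<close> into \<open>t ^ g\<close> times the number of those
  walks whose net number of traversals of every edge off \<open>T\<close> is \<open>1\<close> modulo \<open>t\<close>. The walk and the sum of
  all positively oriented edges are both cycles modulo \<open>t\<close>, and a cycle is determined by its
  coefficients off \<open>T\<close>; so the net number is \<open>1\<close> modulo \<open>t\<close> on all \<open>m\<close> edges. As the walk has length
  \<open>m\<close>, it traverses every edge exactly once, and positively because \<open>t \<ge> 3\<close> excludes
  \<open>-1 = 1\<close> modulo \<open>t\<close>. Each circuit corresponds to \<open>m\<close> such walks.
\<close>

section \<open>Traces of powers as sums over walks\<close>

text \<open>
  Both matrices fit this scheme: take \<open>src = tail G\<close> and \<open>Q e v \<longleftrightarrow> head G e = v\<close> for the adjacency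
  matrix, and \<open>src e = e\<close> and \<open>Q = feeds_into G arev\<close> for the edge adjacency matrix.
\<close>

primrec lwalk :: "('e \<Rightarrow> 'x) \<Rightarrow> ('e \<Rightarrow> 'x \<Rightarrow> bool) \<Rightarrow> 'x \<Rightarrow> 'e list \<Rightarrow> 'x \<Rightarrow> bool" where
  "lwalk src Q x [] y \<longleftrightarrow> x = y"
| "lwalk src Q x (e # p) y \<longleftrightarrow> src e = x \<and> (\<exists>z. Q e z \<and> lwalk src Q z p y)"

lemma lwalk_snoc: "lwalk src Q x (p @ [e]) y \<longleftrightarrow> lwalk src Q x p (src e) \<and> Q e y"
  by (induction p arbitrary: x) auto

text \<open>Induction on the exponent, splitting off the last edge of a walk. \<open>Q\<close> says
  where an edge may end, so an edge need not determine its end label.\<close>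

lemma pow_mat_lwalk:
  fixes w :: "'e \<Rightarrow> 'a :: comm_semiring_1"
  assumes xs: "distinct xs" and A: "finite A" "src ` A \<subseteq> set xs"
    and ij: "i < length xs" "j < length xs"
  shows "(mat (length xs) (length xs)
            (\<lambda>(i, j). \<Sum>e | e \<in> A \<and> src e = xs ! i \<and> Q e (xs ! j). w e) ^\<^sub>m k) $$ (i, j) =
         (\<Sum>p | length p = k \<and> set p \<subseteq> A \<and> lwalk src Q (xs ! i) p (xs ! j). prod_list (map w p))"
    (is "(?N ^\<^sub>m k) $$ _ = (\<Sum>p\<in>?P k (xs ! i) (xs ! j). _)")
  using ij(2)
proof (induction k arbitrary: j)
  case 0
  \<comment> \<open>As labels are distinct, equal labels mean equal indices, so the empty walk
    accounts for the identity matrix.\<close>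
  have "?P 0 (xs ! i) (xs ! j) = (if i = j then {[]} else {})"
    using 0 ij xs by (auto simp: nth_eq_iff_index_eq)
  then show ?case using 0 ij by simp
next
  case (Suc k)
  have fin: "finite (?P k x y)" for x y
    by (rule finite_subset[OF _ finite_lists_length_eq[OF A(1), of k]]) auto
  have "(?N ^\<^sub>m Suc k) $$ (i, j) = (\<Sum>l<length xs. (?N ^\<^sub>m k) $$ (i, l) * ?N $$ (l, j))"
    using Suc.prems ij(1) by (simp add: scalar_prod_def lessThan_atLeast0)
  also have "\<dots> = (\<Sum>l<length xs. \<Sum>p\<in>?P k (xs ! i) (xs ! l). \<Sum>e | e \<in> A \<and> src e = xs ! l \<and> Q e (xs ! j).
      prod_list (map w p) * w e)"
    using Suc.prems by (intro sum.cong refl) (simp add: Suc.IH sum_product)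
  also have "\<dots> = (\<Sum>(l, p, e)\<in>Sigma {..<length xs} (\<lambda>l. ?P k (xs ! i) (xs ! l) \<times>
      {e. e \<in> A \<and> src e = xs ! l \<and> Q e (xs ! j)}). prod_list (map w p) * w e)"
    using fin A(1) by (simp add: sum.Sigma sum.cartesian_product)
  also have "\<dots> = (\<Sum>q\<in>?P (Suc k) (xs ! i) (xs ! j). prod_list (map w q))"
  \<comment> \<open>A triple \<open>(l, p, e)\<close> corresponds to the walk
    \<open>p @ [e]\<close>; the index \<open>l\<close> is recovered as the unique position of
    \<open>src e\<close> in \<open>xs\<close>.\<close>
  proof (subst sum.reindex_bij_betw[where h = "\<lambda>(l, p, e). p @ [e]", symmetric])
    show "bij_betw (\<lambda>(l, p, e). p @ [e]) (Sigma {..<length xs} (\<lambda>l. ?P k (xs ! i) (xs ! l) \<times>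
      {e. e \<in> A \<and> src e = xs ! l \<and> Q e (xs ! j)})) (?P (Suc k) (xs ! i) (xs ! j))"
      (is "bij_betw ?h ?S ?R")
    proof (rule bij_betw_imageI)
      show "inj_on ?h ?S" using xs by (auto simp: inj_on_def nth_eq_iff_index_eq)
      show "?h ` ?S = ?R"
      proof (intro equalityI subsetI)
        fix q assume "q \<in> ?h ` ?S" then show "q \<in> ?R" by (auto simp: lwalk_snoc)
      next
        fix q assume q: "q \<in> ?R"
        then obtain p e where [simp]: "q = p @ [e]" by (cases q rule: rev_cases) auto
        from q A(2) have "src e \<in> set xs" by auto
        then obtain l where "l < length xs" "xs ! l = src e" by (auto simp: in_set_conv_nth)
        with q show "q \<in> ?h ` ?S"
          by (intro image_eqI[of _ _ "(l, p, e)"]) (auto simp: lwalk_snoc)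
      qed
    qed
  qed (auto intro!: sum.cong)
  finally show ?case .
qed

text \<open>A nonempty walk starts at the source of its first edge, so different diagonal entries
  count disjoint sets of walks. For \<open>k = 0\<close> the empty walk would belong to every
  diagonal entry, hence \<open>k > 0\<close>.\<close>

lemma mat_trace_pow_lwalk:
  fixes w :: "'e \<Rightarrow> 'a :: comm_semiring_1"
  assumes xs: "distinct xs" and A: "finite A" "src ` A \<subseteq> set xs" and k: "k > 0"
  shows "mat_trace (mat (length xs) (length xs)
            (\<lambda>(i, j). \<Sum>e | e \<in> A \<and> src e = xs ! i \<and> Q e (xs ! j). w e) ^\<^sub>m k) =
         (\<Sum>p | length p = k \<and> set p \<subseteq> A \<and> (\<exists>x\<in>set xs. lwalk src Q x p x). prod_list (map w p))"
    (is "mat_trace (?N ^\<^sub>m k) = _")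
proof -
  let ?P = "\<lambda>x. {p. length p = k \<and> set p \<subseteq> A \<and> lwalk src Q x p x}"
  have fin: "finite (?P x)" for x
    by (rule finite_subset[OF _ finite_lists_length_eq[OF A(1), of k]]) auto
  have src_hd: "x = src (hd p)" if "p \<in> ?P x" for p x
    using that k by (cases p) auto
  have "mat_trace (?N ^\<^sub>m k) = (\<Sum>i<length xs. (?N ^\<^sub>m k) $$ (i, i))"
    by (simp add: mat_trace_def)
  also have "\<dots> = (\<Sum>i<length xs. \<Sum>p\<in>?P (xs ! i). prod_list (map w p))"
    using xs A by (intro sum.cong refl pow_mat_lwalk) auto
  also have "\<dots> = (\<Sum>x\<in>set xs. \<Sum>p\<in>?P x. prod_list (map w p))"
    using bij_betw_nth[OF xs refl refl] by (intro sum.reindex_bij_betw)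
  also have "\<dots> = (\<Sum>p\<in>(\<Union>x\<in>set xs. ?P x). prod_list (map w p))"
    using fin src_hd by (intro sum.UNION_disjoint[symmetric]) blast+
  finally show ?thesis
    by (rule trans) (rule sum.cong, auto)
qed

section \<open>Rotation classes of lists\<close>

lemma card_distinct_rotations:
  assumes "distinct p" "p \<noteq> []"
  shows "card (range (\<lambda>k. rotate k p)) = length p"
proof -
  have "range (\<lambda>k. rotate k p) = (\<lambda>k. rotate k p) ` {..<length p}"
    using assms(2) by (auto simp: image_iff) (metis lessThan_iff length_greater_0_conv mod_less_divisor rotate_conv_mod)
  moreover have "inj_on (\<lambda>k. rotate k p) {..<length p}"
  proof (rule inj_onI)
    \<comment> \<open>For \<open>k < length p\<close> the first entry of \<open>rotate k p\<close>
      is \<open>p ! k\<close>, which determines \<open>k\<close> when \<open>p\<close> is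
      distinct.\<close>
    fix k l assume kl: "k \<in> {..<length p}" "l \<in> {..<length p}" and "rotate k p = rotate l p"
    then have "p ! k = p ! l" using hd_rotate_conv_nth[OF assms(2)] by (metis lessThan_iff mod_less)
    with kl assms(1) show "k = l" by (simp add: nth_eq_iff_index_eq)
  qed
  ultimately show ?thesis by (simp add: card_image)
qed

text \<open>The classes are the orbits under rotation. They partition \<open>S\<close>, and each has
  \<open>m\<close> elements because its lists are distinct.\<close>

lemma card_rotation_classes:
  fixes S :: "'a list set"
  assumes fin: "finite S" and m: "m > 0"
    and S: "\<And>p. p \<in> S \<Longrightarrow> distinct p \<and> length p = m"
    and closed: "\<And>p k. p \<in> S \<Longrightarrow> rotate k p \<in> S"
  shows "card S = m * card (S // {(p, q). \<exists>k. q = rotate k p})"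
proof -
  let ?R = "{(p, q). \<exists>k. q = rotate k p}" and ?O = "\<lambda>p::'a list. range (\<lambda>k. rotate k p)"
  have quot: "S // ?R = ?O ` S" by (auto simp: quotient_def)
  have Un: "\<Union>(?O ` S) = S"
  proof
    show "S \<subseteq> \<Union>(?O ` S)"
    proof
      fix p assume "p \<in> S"
      moreover have "p = rotate 0 p" by simp
      ultimately show "p \<in> \<Union>(?O ` S)" by blast
    qed
  qed (use closed in auto)
  \<comment> \<open>Rotating \<open>(length p - 1) * k\<close> further times makes a total of
    \<open>length p * k\<close>, which is the identity.\<close>
  have undo_rot: "\<exists>l. p = rotate l (rotate k p)" for p :: "'a list" and k
  proof (cases "p = []")
    case False
    then have "(length p - 1) * k + k = length p * k" by (cases p) auto
    then have "rotate ((length p - 1) * k) (rotate k p) = p"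
      by (simp add: rotate_rotate rotate_id)
    then show ?thesis by metis
  qed simp
  have sub: "?O p \<subseteq> ?O (rotate k p)" for p k
  proof
    fix q assume "q \<in> ?O p"
    then obtain j where "q = rotate j p" by auto
    moreover obtain l where "p = rotate l (rotate k p)" using undo_rot by blast
    ultimately have "q = rotate (j + l) (rotate k p)" by (metis rotate_rotate)
    then show "q \<in> ?O (rotate k p)" by blast
  qed
  have orbit_eq: "?O (rotate k p) = ?O p" for p k
  proof
    show "?O (rotate k p) \<subseteq> ?O p" by (auto simp: rotate_rotate)
  qed (rule sub)
  have "m * card (?O ` S) = card (\<Union>(?O ` S))"
  proof (rule card_partition)
    show "card c = m" if "c \<in> ?O ` S" for c
      using that S m card_distinct_rotations by fastforce
    show "c1 \<inter> c2 = {}" if "c1 \<in> ?O ` S" "c2 \<in> ?O ` S" "c1 \<noteq> c2" for c1 c2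
    proof (rule ccontr)
      from that obtain p q where c: "c1 = ?O p" "c2 = ?O q" by blast
      assume "c1 \<inter> c2 \<noteq> {}"
      with c obtain k l where "rotate k p = rotate l q" by blast
      with orbit_eq[of k p] orbit_eq[of l q] c have "c1 = c2" by simp
      with \<open>c1 \<noteq> c2\<close> show False ..
    qed
  qed (use fin Un in auto)
  with Un quot show ?thesis by simp
qed

section \<open>Roots of unity\<close>

lemma root_eps_nonzero: "root_eps t \<noteq> 0" by (simp add: root_eps_def)

lemma root_eps_powi: "root_eps t powi k = cis (2 * pi * of_int k / of_nat t)"
proof -
  have "root_eps t = cis (2 * pi / of_nat t)"
    by (simp add: root_eps_def cis_conv_exp algebra_simps)
  then show ?thesis by (simp add: cis_power_int algebra_simps)
qed

text \<open>Comparing real parts suffices: the cosine is \<open>1\<close> only at multiples of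
  \<open>2 * pi\<close>.\<close>

lemma root_eps_powi_eq_1_iff:
  assumes "t > 0"
  shows "root_eps t powi k = 1 \<longleftrightarrow> int t dvd k"
proof
  assume "root_eps t powi k = 1"
  then have "cos (2 * pi * of_int k / of_nat t) = 1"
    by (simp add: root_eps_powi complex_eq_iff)
  then obtain l :: int where "2 * pi * of_int k / of_nat t = of_int l * 2 * pi"
    by (auto simp: cos_one_2pi_int)
  with assms have "of_int k = (of_int (l * int t) :: real)"
    by (simp add: field_simps)
  then show "int t dvd k" by (simp only: of_int_eq_iff) simp
next
  assume "int t dvd k"
  then obtain l where "k = int t * l" ..
  with assms show "root_eps t powi k = 1"
    using cis_multiple_2pi[of "of_int l"] by (simp add: root_eps_powi mult.assoc)
qed

text \<open>Lets residues in \<open>{0..<int t}\<close> be replaced by arbitrary integer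
  representatives in exponents.\<close>

lemma root_eps_powi_mod:
  assumes "t > 0"
  shows "root_eps t powi (k mod int t) = root_eps t powi k"
proof -
  have "root_eps t powi k = root_eps t powi (int t * (k div int t)) * root_eps t powi (k mod int t)"
    by (subst power_int_add[symmetric]) (simp_all add: root_eps_nonzero)
  with assms show ?thesis by (simp add: root_eps_powi_eq_1_iff)
qed

text \<open>Orthogonality of characters of the cyclic group: a geometric sum whose ratio
  \<open>?z\<close> satisfies \<open>?z ^ t = 1\<close>, so it vanishes unless
  \<open>?z = 1\<close>.\<close>

lemma sum_root_eps_powi:
  assumes "t > 0"
  shows "(\<Sum>c\<in>{0..<int t}. root_eps t powi (c * k)) = (if int t dvd k then of_nat t else 0)"
proof -
  let ?z = "root_eps t powi k"
  have "root_eps t powi (int n * k) = ?z ^ n" for n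
    by (metis mult.commute power_int_mult power_int_of_nat)
  then have "root_eps t powi (c * k) = ?z ^ nat c" if "c \<ge> 0" for c
    using that by (metis int_nat_eq)
  then have "(\<Sum>c\<in>{0..<int t}. root_eps t powi (c * k)) = (\<Sum>n<t. ?z ^ n)"
    by (intro sum.reindex_bij_witness[of _ int nat]) auto
  also have "\<dots> = (if int t dvd k then of_nat t else 0)"
  proof (cases "int t dvd k")
    case True
    with assms have "?z = 1" by (simp add: root_eps_powi_eq_1_iff)
    with True show ?thesis by simp
  next
    case False
    have "?z ^ t = root_eps t powi (k * int t)" by (simp add: power_int_mult)
    with False assms show ?thesis by (simp add: root_eps_powi_eq_1_iff geometric_sum)
  qed
  finally show ?thesis .
qed

text \<open>A chain in \<open>M t Eo F\<close> is a free choice of one residue for each edge of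
  \<open>F\<close>, so the sum factors into one geometric sum per edge.\<close>

lemma sum_M_root_eps_powi:
  assumes t: "t > 0" and Eo: "finite Eo" and F: "F \<subseteq> Eo"
  shows "(\<Sum>\<gamma>\<in>M t Eo F. root_eps t powi (\<Sum>e\<in>F. \<gamma> e * k e)) =
         (if \<forall>e\<in>F. int t dvd k e then of_nat t ^ card F else 0)"
proof -
  have finF: "finite F" using Eo F finite_subset by blast
  have powi_sum: "root_eps t powi (\<Sum>e\<in>F. h e) = (\<Prod>e\<in>F. root_eps t powi h e)" for h
    using finF by (induction F) (simp_all add: power_int_add root_eps_nonzero)
  have "(\<Sum>\<gamma>\<in>M t Eo F. root_eps t powi (\<Sum>e\<in>F. \<gamma> e * k e)) =
      (\<Sum>\<gamma>\<in>F \<rightarrow>\<^sub>E {0..<int t}. \<Prod>e\<in>F. root_eps t powi (\<gamma> e * k e))"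
    using F t
    \<comment> \<open>Chains are zero outside \<open>F\<close>, whereas elements of the function
      space are \<open>undefined\<close> there; the two maps exchange these conventions.\<close>
    by (intro sum.reindex_bij_witness[of _ "\<lambda>\<gamma> e. if e \<in> F then \<gamma> e else 0" "\<lambda>\<gamma>. restrict \<gamma> F"])
      (force simp: M_def C1_def powi_sum fun_eq_iff PiE_iff extensional_def intro!: prod.cong)+
  also have "\<dots> = (\<Prod>e\<in>F. \<Sum>c\<in>{0..<int t}. root_eps t powi (c * k e))"
    using finF by (simp add: prod_sum_PiE)
  also have "\<dots> = (\<Prod>e\<in>F. if int t dvd k e then of_nat t else 0)"
    using t by (simp add: sum_root_eps_powi)
  also have "\<dots> = (if \<forall>e\<in>F. int t dvd k e then of_nat t ^ card F else 0)"
    using finF by (auto intro: prod_zero)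
  finally show ?thesis .
qed

section \<open>Cut sums along walks and occurrence counts\<close>

text \<open>The sum telescopes. For a closed walk it is zero: the walk leaves \<open>S\<close> as
  often as it enters.\<close>

lemma sum_list_cut_cas:
  assumes "pre_digraph.cas G u p w"
  shows "(\<Sum>e\<leftarrow>p. of_bool (tail G e \<in> S) - of_bool (head G e \<in> S) :: int) =
    of_bool (u \<in> S) - of_bool (w \<in> S)"
  using assms by (induction p arbitrary: u) (auto simp: pre_digraph.cas.simps)

lemma count_list_distinct: "distinct xs \<Longrightarrow> count_list xs x = of_bool (x \<in> set xs)"
  by (induction xs) auto

section \<open>Spanning trees\<close>

context conn_multigraph begin

lemma finite_edges: "finite (edges G arev)"
  by (simp add: edges_def)

lemma edge_of_eq_iff: "edge_of arev x = edge_of arev y \<longleftrightarrow> x = y \<or> x = arev y"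
  by (auto simp: edge_of_def doubleton_eq_iff)

lemma edge_of_arev: "edge_of arev (arev x) = edge_of arev x"
  by (simp add: edge_of_eq_iff)

text \<open>Edges are the orbits of \<open>arev\<close>, hence pairwise disjoint, so an oriented
  edge lies in only one of them.\<close>

lemma mem_edge_set_iff:
  assumes "X \<subseteq> edges G arev"
  shows "e \<in> \<Union>X \<longleftrightarrow> edge_of arev e \<in> X"
proof
  assume "e \<in> \<Union>X"
  then obtain a where a: "a \<in> X" "e \<in> a" by blast
  with assms obtain f where f: "a = edge_of arev f" by (auto simp: edges_def)
  with a have "e = f \<or> e = arev f" by (auto simp: edge_of_def)
  then show "edge_of arev e \<in> X" using a f edge_of_eq_iff by metis
qed (auto simp: edge_of_def)

lemma edge_set_subset_arcs:
  assumes "X \<subseteq> edges G arev"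
  shows "\<Union>X \<subseteq> arcs G"
  using assms by (auto simp: edges_def edge_of_def)

text \<open>A union of edges is closed under \<open>arev\<close>. This makes reachability symmetric
  in the subgraph, which keeps all vertices of \<open>G\<close>.\<close>

lemma sym_digraph_edge_set:
  assumes X: "X \<subseteq> edges G arev"
  shows "sym_digraph (G\<lparr>arcs := \<Union>X\<rparr>)"
proof -
  have arcs: "e \<in> arcs G" if "e \<in> \<Union>X" for e using edge_set_subset_arcs[OF X] that by blast
  have arev_closed: "arev e \<in> \<Union>X" if "e \<in> \<Union>X" for e
    using that mem_edge_set_iff[OF X] edge_of_arev by simp
  have "symmetric (G\<lparr>arcs := \<Union>X\<rparr>)"
    unfolding symmetric_conv
  proof (intro ballI bexI conjI)
    fix e assume "e \<in> arcs (G\<lparr>arcs := \<Union>X\<rparr>)"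
    then have e: "e \<in> \<Union>X" by simp
    show "tail (G\<lparr>arcs := \<Union>X\<rparr>) e = head (G\<lparr>arcs := \<Union>X\<rparr>) (arev e)"
      "head (G\<lparr>arcs := \<Union>X\<rparr>) e = tail (G\<lparr>arcs := \<Union>X\<rparr>) (arev e)"
      using arcs[OF e] by simp_all
    show "arev e \<in> arcs (G\<lparr>arcs := \<Union>X\<rparr>)"
      using arev_closed[OF e] by simp
  qed
  then show ?thesis
    using arcs by unfold_locales auto
qed

text \<open>Using the first edge again, in either direction, would revisit the start vertex.
  Distinctness of unoriented edges is what the cycles excluded by \<open>is_spanning_tree\<close>
  require.\<close>

lemma distinct_edges_apath:
  assumes X: "X \<subseteq> edges G arev" and "pre_digraph.apath (G\<lparr>arcs := \<Union>X\<rparr>) u p v"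
  shows "distinct (map (edge_of arev) p)"
proof -
  interpret X: sym_digraph "G\<lparr>arcs := \<Union>X\<rparr>" by (rule sym_digraph_edge_set[OF X])
  have arcs: "e \<in> arcs G" if "e \<in> \<Union>X" for e using edge_set_subset_arcs[OF X] that by blast
  show ?thesis
    using assms(2)
  proof (induction p arbitrary: u)
    case (Cons e p)
    then have e: "e \<in> \<Union>X" "u = tail G e" "X.apath (head G e) p v"
      and notin: "u \<notin> set (X.awalk_verts (head G e) p)"
      by (auto simp: X.apath_Cons_iff)
    have walk: "X.awalk (head G e) p v" using e(3) by (simp add: X.apath_def)
    have "edge_of arev e \<notin> edge_of arev ` set p"
    proof
      assume "edge_of arev e \<in> edge_of arev ` set p"
      then obtain f where f: "f \<in> set p" "e = f \<or> e = arev f" by (auto simp: edge_of_eq_iff)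
      have "set p \<subseteq> \<Union>X" using walk by (simp add: X.awalk_def)
      with f(1) have "f \<in> arcs G" by (intro arcs) (rule subsetD)
      with f e(2) have "u = tail G f \<or> u = head G f" by auto
      with f(1) notin X.set_awalk_verts[OF walk] show False by auto
    qed
    with Cons.IH[OF e(3)] show ?case by simp
  qed simp
qed

text \<open>A simple path from \<open>head G e\<close> back to \<open>tail G e\<close> avoiding the
  edge of \<open>e\<close> would close up with \<open>e\<close> to a cycle in the tree.\<close>

lemma tree_edge_separates:
  assumes T: "is_spanning_tree G arev T" and e: "e \<in> \<Union>T"
  shows "\<not> head G e \<rightarrow>\<^sup>*\<^bsub>G\<lparr>arcs := \<Union>(T - {edge_of arev e})\<rparr>\<^esub> tail G e"
proof
  let ?X = "T - {edge_of arev e}"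
  have TE: "T \<subseteq> edges G arev" using T by (simp add: is_spanning_tree_def)
  then have XE: "?X \<subseteq> edges G arev" by auto
  interpret T: sym_digraph "G\<lparr>arcs := \<Union>T\<rparr>" by (rule sym_digraph_edge_set[OF TE])
  interpret X: sym_digraph "G\<lparr>arcs := \<Union>?X\<rparr>" by (rule sym_digraph_edge_set[OF XE])
  assume "head G e \<rightarrow>\<^sup>*\<^bsub>G\<lparr>arcs := \<Union>?X\<rparr>\<^esub> tail G e"
  then obtain p where p: "X.apath (head G e) p (tail G e)" by (auto simp: X.reachable_apath)
  \<comment> \<open>Vertex sequences and \<open>cas\<close> depend only on \<open>tail\<close> and
    \<open>head\<close>, which both subgraphs inherit from \<open>G\<close>; only the set of allowed
    arcs differs.\<close>
  have verts_eq: "T.awalk_verts u q = X.awalk_verts u q" for u q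
    by (induction q arbitrary: u) (simp_all add: T.awalk_verts.simps X.awalk_verts.simps)
  have cas_eq: "T.cas u q v = X.cas u q v" for u q v
    by (induction q arbitrary: u) (simp_all add: T.cas.simps X.cas.simps)
  have "T.awalk (head G e) p (tail G e)"
    using p by (auto simp: X.apath_def X.awalk_def T.awalk_def cas_eq)
  with e have "T.awalk (tail G e) (e # p) (tail G e)" by (auto simp: T.awalk_Cons_iff)
  moreover have "distinct (tl (T.awalk_verts (tail G e) (e # p)))"
    using p by (simp add: verts_eq X.apath_def X.awalk_verts.simps)
  ultimately have "T.cycle (e # p)" by (auto simp: T.cycle_def)
  moreover have "edge_of arev e \<notin> edge_of arev ` set p"
  proof -
    have "set p \<subseteq> \<Union>?X" using p by (auto simp: X.apath_def X.awalk_def)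
    then show ?thesis using mem_edge_set_iff[OF XE] by fastforce
  qed
  ultimately show False
    using T distinct_edges_apath[OF XE p] by (auto simp: is_spanning_tree_def)
qed

text \<open>
  Matches every vertex other than a root with the first edge of a shortest walk to the root.
\<close>

lemma card_spanning_tree:
  assumes T: "is_spanning_tree G arev T"
  shows "Suc (card T) = card (verts G)"
proof -
  have TE: "T \<subseteq> edges G arev" using T by (simp add: is_spanning_tree_def)
  interpret T: sym_digraph "G\<lparr>arcs := \<Union>T\<rparr>" by (rule sym_digraph_edge_set[OF TE])
  have T_arcs: "\<Union>T \<subseteq> arcs G" by (rule edge_set_subset_arcs[OF TE])
  have conn: "strongly_connected (G\<lparr>arcs := \<Union>T\<rparr>)"
    using T by (intro T.symmetric_connected_imp_strongly_connected) (auto simp: is_spanning_tree_def)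
  then obtain r where r: "r \<in> verts G" by (auto simp: strongly_connected_def)
  \<comment> \<open>The distance from \<open>v\<close> to the root inside the tree; the minimum
    exists because the tree connects every vertex to \<open>r\<close>.\<close>
  define d where "d v = (LEAST n. \<exists>p. T.awalk v p r \<and> length p = n)" for v
  have walk: "\<exists>p. T.awalk v p r \<and> length p = d v" if "v \<in> verts G" for v
  proof -
    have "\<exists>p. T.awalk v p r"
      using conn that r by (auto simp: strongly_connected_def T.reachable_awalk)
    then have "\<exists>n p. T.awalk v p r \<and> length p = n" by blast
    then show ?thesis unfolding d_def by (rule LeastI_ex)
  qed
  have "\<exists>e. e \<in> \<Union>T \<and> tail G e = v \<and> d (head G e) < d v" if v: "v \<in> verts G - {r}" for v
  proof -
    obtain p where p: "T.awalk v p r" "length p = d v" using walk v by auto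
    with v obtain e q where [simp]: "p = e # q" by (cases p) (auto simp: T.awalk_Nil_iff)
    have "T.awalk (head G e) q r" using p by (simp add: T.awalk_Cons_iff)
    then have "d (head G e) \<le> length q" unfolding d_def by (auto intro: Least_le)
    with p show ?thesis by (auto simp: T.awalk_Cons_iff)
  qed
  then obtain par where par: "\<And>v. v \<in> verts G - {r} \<Longrightarrow>
      par v \<in> \<Union>T \<and> tail G (par v) = v \<and> d (head G (par v)) < d v"
    by metis
  let ?par = "\<lambda>v. edge_of arev (par v)"
  have "inj_on ?par (verts G - {r})"
  proof (rule inj_onI)
    fix v w assume v: "v \<in> verts G - {r}" and w: "w \<in> verts G - {r}" and "?par v = ?par w"
    then consider "par v = par w" | "par v = arev (par w)" by (auto simp: edge_of_eq_iff)
    then show "v = w"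
    proof cases
      case 1
      then show ?thesis using par v w by metis
    next
      case 2
      \<comment> \<open>Mutually inverse parent edges would require both \<open>d w < d v\<close>
        and \<open>d v < d w\<close>.\<close>
      have "par w \<in> arcs G" using par[OF w] T_arcs by blast
      with 2 have "tail G (par v) = head G (par w)" "head G (par v) = tail G (par w)" by simp_all
      with par[OF v] par[OF w] have False by simp
      then show ?thesis ..
    qed
  qed
  moreover have "?par ` (verts G - {r}) = T"
  proof
    show "?par ` (verts G - {r}) \<subseteq> T" using par mem_edge_set_iff[OF TE] by blast
    show "T \<subseteq> ?par ` (verts G - {r})"
    proof
      fix a assume a: "a \<in> T"
      then obtain e where e: "e \<in> arcs G" "a = edge_of arev e" using TE by (auto simp: edges_def)
      with a have eT: "e \<in> \<Union>T" using mem_edge_set_iff[OF TE] by simp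
      let ?X = "T - {edge_of arev e}"
      have XE: "?X \<subseteq> edges G arev" using TE by auto
      interpret X: sym_digraph "G\<lparr>arcs := \<Union>?X\<rparr>" by (rule sym_digraph_edge_set[OF XE])
      show "a \<in> ?par ` (verts G - {r})"
      proof (rule ccontr)
        \<comment> \<open>If \<open>a\<close> is no parent edge, following parent edges leads from
          every vertex to \<open>r\<close> without \<open>a\<close>, so the ends of \<open>e\<close>
          stay connected after its removal.\<close>
        assume not: "a \<notin> ?par ` (verts G - {r})"
        have to_r: "v \<rightarrow>\<^sup>*\<^bsub>G\<lparr>arcs := \<Union>?X\<rparr>\<^esub> r" if "v \<in> verts G" for v
          using that
        proof (induction "d v" arbitrary: v rule: less_induct)
          case less
          show ?case
          proof (cases "v = r")
            case True
            with r show ?thesis by (simp add: X.reachable_refl)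
          next
            case False
            with less.prems have v: "v \<in> verts G - {r}" by simp
            have "?par v \<in> ?X" using par[OF v] not v e mem_edge_set_iff[OF TE] by auto
            then have p: "par v \<in> \<Union>?X" using mem_edge_set_iff[OF XE] by simp
            have "head G (par v) \<in> verts G" using par[OF v] T_arcs by auto
            with less.hyps par[OF v] have "head G (par v) \<rightarrow>\<^sup>*\<^bsub>G\<lparr>arcs := \<Union>?X\<rparr>\<^esub> r" by blast
            then obtain q where "X.awalk (head G (par v)) q r" by (auto simp: X.reachable_awalk)
            with p par[OF v] have "X.awalk v (par v # q) r" by (auto simp: X.awalk_Cons_iff)
            then show ?thesis by (rule X.reachable_awalkI)
          qed
        qed
        have "head G e \<rightarrow>\<^sup>*\<^bsub>G\<lparr>arcs := \<Union>?X\<rparr>\<^esub> tail G e"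
        proof -
          have "tail G e \<rightarrow>\<^sup>*\<^bsub>G\<lparr>arcs := \<Union>?X\<rparr>\<^esub> r" by (rule to_r) (use e in simp)
          then have "r \<rightarrow>\<^sup>*\<^bsub>G\<lparr>arcs := \<Union>?X\<rparr>\<^esub> tail G e" by (rule X.symmetric_reachable')
          moreover have "head G e \<rightarrow>\<^sup>*\<^bsub>G\<lparr>arcs := \<Union>?X\<rparr>\<^esub> r" by (rule to_r) (use e in simp)
          ultimately show ?thesis by (rule X.reachable_trans[rotated])
        qed
        with tree_edge_separates[OF T eT] show False ..
      qed
    qed
  qed
  ultimately have "card T = card (verts G - {r})" using card_image by metis
  moreover have "card (verts G) > 0" using r by (auto simp: card_gt_0_iff)
  ultimately show ?thesis using r by simp
qed

section \<open>Orientations and circuits\<close>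

text \<open>Since \<open>arev\<close> has no fixed point, even on loops, choosing one element of
  \<open>{e, arev e}\<close> means that exactly one of the two is in \<open>Eo\<close>.\<close>

lemma orientation_iff:
  "orientation G arev Eo \<longleftrightarrow> Eo \<subseteq> arcs G \<and> (\<forall>e\<in>arcs G. arev e \<in> Eo \<longleftrightarrow> e \<notin> Eo)"
proof -
  have "(\<exists>!x. x \<in> edge_of arev e \<and> x \<in> Eo) \<longleftrightarrow> (arev e \<in> Eo \<longleftrightarrow> e \<notin> Eo)" if "e \<in> arcs G" for e
    using arev_neq[OF that] by (auto simp: edge_of_def)
  then show ?thesis by (simp add: orientation_def edges_def)
qed

lemma finite_orientation: "orientation G arev Eo \<Longrightarrow> finite Eo"
  using finite_arcs by (auto simp: orientation_def intro: finite_subset)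

lemma bij_betw_edge_of:
  assumes "orientation G arev Eo"
  shows "bij_betw (edge_of arev) Eo (edges G arev)"
proof (rule bij_betw_imageI)
  show "inj_on (edge_of arev) Eo"
    using assms by (auto simp: inj_on_def orientation_iff edge_of_eq_iff)
  show "edge_of arev ` Eo = edges G arev"
  proof
    show "edge_of arev ` Eo \<subseteq> edges G arev" using assms by (auto simp: edges_def orientation_iff)
    show "edges G arev \<subseteq> edge_of arev ` Eo"
    proof
      fix a assume "a \<in> edges G arev"
      then obtain e where e: "e \<in> arcs G" "a = edge_of arev e" by (auto simp: edges_def)
      moreover from e have "e \<in> Eo \<or> arev e \<in> Eo" using assms by (auto simp: orientation_iff)
      ultimately show "a \<in> edge_of arev ` Eo" by (metis edge_of_arev imageI)
    qed
  qed
qed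

lemma card_orientation: "orientation G arev Eo \<Longrightarrow> card Eo = card (edges G arev)"
  by (rule bij_betw_same_card[OF bij_betw_edge_of])

text \<open>\<open>Eo\<close> has one element over each of the \<open>m\<close> edges, and
  \<open>n - 1\<close> of these lie over the tree. This is where the exponent \<open>g\<close> of
  \<open>t\<close> comes from.\<close>

lemma card_off_tree:
  assumes T: "is_spanning_tree G arev T" and Eo: "orientation G arev Eo"
  shows "int (card (off_tree Eo T)) = genus G arev"
proof -
  have TE: "T \<subseteq> edges G arev" using T by (simp add: is_spanning_tree_def)
  note bij = bij_betw_edge_of[OF Eo]
  have "edge_of arev ` (Eo \<inter> \<Union>T) = T"
  proof
    show "T \<subseteq> edge_of arev ` (Eo \<inter> \<Union>T)"
    proof
      fix a assume a: "a \<in> T"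
      with TE bij_betw_imp_surj_on[OF bij] obtain e where "e \<in> Eo" "a = edge_of arev e" by blast
      with a show "a \<in> edge_of arev ` (Eo \<inter> \<Union>T)" using mem_edge_set_iff[OF TE] by blast
    qed
  qed (use mem_edge_set_iff[OF TE] in blast)
  then have "card (Eo \<inter> \<Union>T) = card T"
    using bij_betw_imp_inj_on[OF bij] by (metis card_image inf_le1 inj_on_subset)
  moreover have "card Eo = card (Eo \<inter> \<Union>T) + card (off_tree Eo T)"
    unfolding off_tree_def using finite_orientation[OF Eo] by (subst card_Un_disjoint[symmetric]) (auto intro: arg_cong[where f = card])
  ultimately show ?thesis
    using card_spanning_tree[OF T] card_orientation[OF Eo] by (simp add: genus_def)
qed

text \<open>Each edge has exactly one element in \<open>Eo\<close>, so traversing every edge once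
  within \<open>Eo\<close> means listing \<open>Eo\<close> without repetition.\<close>

lemma oriented_circuits_eq:
  assumes Eo: "orientation G arev Eo"
  shows "oriented_circuits G arev Eo = {p. closed_walk G p \<and> distinct p \<and> set p = Eo}"
proof (intro Set.set_eqI iffI)
  fix p assume "p \<in> oriented_circuits G arev Eo"
  then have p: "closed_walk G p" "set p \<subseteq> Eo"
    and once: "\<And>a. a \<in> edges G arev \<Longrightarrow> \<exists>!i. i < length p \<and> p ! i \<in> a"
    by (auto simp: oriented_circuits_def eulerian_circuit_def)
  have edge: "edge_of arev e \<in> edges G arev" "e \<in> edge_of arev e" if "e \<in> Eo" for e
    using Eo that by (auto simp: orientation_def edges_def edge_of_def)
  have "distinct p"
    unfolding distinct_conv_nth
  proof (intro allI impI notI)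
    fix i j assume "i < length p" "j < length p" "i \<noteq> j" "p ! i = p ! j"
    moreover from this have "p ! i \<in> Eo" using p(2) by (auto simp: subset_iff)
    ultimately show False using once[OF edge(1)] edge(2) by metis
  qed
  moreover have "Eo \<subseteq> set p"
  proof
    fix e assume e: "e \<in> Eo"
    obtain i where i: "i < length p" "p ! i \<in> edge_of arev e" using once[OF edge(1)[OF e]] by blast
    then have "p ! i \<in> Eo" using p(2) by (auto simp: subset_iff)
    with i e Eo have "p ! i = e" by (auto simp: edge_of_def orientation_iff)
    with i show "e \<in> set p" by auto
  qed
  ultimately show "p \<in> {p. closed_walk G p \<and> distinct p \<and> set p = Eo}" using p by auto
next
  fix p assume "p \<in> {p. closed_walk G p \<and> distinct p \<and> set p = Eo}"
  then have p: "closed_walk G p" "distinct p" "set p = Eo" by auto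
  have "\<exists>!i. i < length p \<and> p ! i \<in> a" if "a \<in> edges G arev" for a
  proof -
    obtain e where e: "e \<in> a" "e \<in> Eo" "\<And>f. f \<in> a \<Longrightarrow> f \<in> Eo \<Longrightarrow> f = e"
      using Eo \<open>a \<in> edges G arev\<close> unfolding orientation_def by metis
    then obtain i where i: "i < length p" "p ! i = e" using p(3) by (metis in_set_conv_nth)
    show ?thesis
    proof (rule ex1I[of _ i])
      fix j assume j: "j < length p \<and> p ! j \<in> a"
      with e p(3) have "p ! j = e" by (metis nth_mem)
      with i j p(2) show "j = i" by (auto simp: nth_eq_iff_index_eq)
    qed (use i e(1) in simp)
  qed
  with p show "p \<in> oriented_circuits G arev Eo"
    by (simp add: oriented_circuits_def eulerian_circuit_def)
qed

lemma closed_walk_rotate: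
  assumes "closed_walk G p"
  shows "closed_walk G (rotate k p)"
proof (induction k)
  case (Suc k)
  then obtain u where "awalk u (rotate k p) u" "rotate k p \<noteq> []" by (auto simp: closed_walk_def)
  then show ?case
    by (cases "rotate k p") (auto simp: closed_walk_def awalk_Cons_iff awalk_Nil_iff)
qed (use assms in simp)

text \<open>Source of the factor \<open>m\<close>: a circuit up to rotation has \<open>m\<close>
  distinct representatives, one for each starting edge.\<close>

lemma card_oriented_circuits:
  assumes Eo: "orientation G arev Eo" and ne: "edges G arev \<noteq> {}"
  shows "card (oriented_circuits G arev Eo) = card (edges G arev) * ec G arev Eo"
  unfolding ec_def
proof (rule card_rotation_classes)
  note eq = oriented_circuits_eq[OF Eo]
  show len: "distinct p \<and> length p = card (edges G arev)" if "p \<in> oriented_circuits G arev Eo" for p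
    using that distinct_card[of p] card_orientation[OF Eo] by (simp add: eq)
  show "rotate k p \<in> oriented_circuits G arev Eo" if "p \<in> oriented_circuits G arev Eo" for p k
    using that closed_walk_rotate by (simp add: eq)
  have "oriented_circuits G arev Eo \<subseteq> {p. set p \<subseteq> Eo \<and> length p = card (edges G arev)}"
    using len by (auto simp: eq)
  then show "finite (oriented_circuits G arev Eo)"
    using finite_lists_length_eq[OF finite_orientation[OF Eo]] finite_subset by blast
  show "card (edges G arev) > 0" using ne finite_edges by (simp add: card_gt_0_iff)
qed

section \<open>Net traversal numbers and balance across cuts\<close>

text \<open>The coefficient of \<open>e\<close> in the integral 1-chain carried by the walk
  \<open>p\<close>.\<close>

definition net :: "'e list \<Rightarrow> 'e \<Rightarrow> int" where
  "net p e = int (count_list p e) - int (count_list p (arev e))"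

text \<open>A weight that changes sign under \<open>arev\<close> sees only the 1-chain of
  \<open>p\<close>. It is applied to cut functions and to exponents of characters.\<close>

lemma sum_list_antisym:
  fixes \<phi> :: "'e \<Rightarrow> int"
  assumes Eo: "orientation G arev Eo" and p: "set p \<subseteq> arcs G"
    and anti: "\<And>e. e \<in> arcs G \<Longrightarrow> \<phi> (arev e) = - \<phi> e"
  shows "(\<Sum>e\<leftarrow>p. \<phi> e) = (\<Sum>e\<in>Eo. net p e * \<phi> e)"
  using p
proof (induction p)
  case (Cons a p)
  have fin: "finite Eo" by (rule finite_orientation[OF Eo])
  have Eo_iff: "arev e \<in> Eo \<longleftrightarrow> e \<notin> Eo" if "e \<in> arcs G" for e using Eo that by (simp add: orientation_iff)
  have a: "a \<in> arcs G" using Cons.prems by simp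
  have net: "net (a # p) e = net p e + (if e = a then 1 else 0) - (if e = arev a then 1 else 0)" for e
    by (auto simp: net_def)
  have "(\<Sum>e\<in>Eo. net (a # p) e * \<phi> e) =
      (\<Sum>e\<in>Eo. net p e * \<phi> e) + (\<Sum>e\<in>Eo. if e = a then \<phi> e else 0) - (\<Sum>e\<in>Eo. if e = arev a then \<phi> e else 0)"
    unfolding sum.distrib[symmetric] sum_subtractf[symmetric]
    by (intro sum.cong) (auto simp: net algebra_simps)
  \<comment> \<open>Just one of \<open>a\<close> and \<open>arev a\<close> is in \<open>Eo\<close>;
    if it is \<open>arev a\<close>, the term \<open>- \<phi> (arev a)\<close> equals
    \<open>\<phi> a\<close>.\<close>
  also have "\<dots> = (\<Sum>e\<in>Eo. net p e * \<phi> e) + \<phi> a"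
    using fin a Eo_iff[OF a] anti[OF a] by (cases "a \<in> Eo") (simp_all add: sum.delta)
  finally show ?case using Cons by simp
qed (simp add: net_def)

text \<open>Every oriented edge is either in \<open>Eo\<close> or the inverse of a unique element of
  \<open>Eo\<close>.\<close>

lemma length_eq_sum_count:
  assumes Eo: "orientation G arev Eo" and p: "set p \<subseteq> arcs G"
  shows "length p = (\<Sum>e\<in>Eo. count_list p e + count_list p (arev e))"
proof -
  have fin: "finite Eo" by (rule finite_orientation[OF Eo])
  have arcs: "arcs G = Eo \<union> arev ` Eo" "Eo \<inter> arev ` Eo = {}"
  proof -
    show "arcs G = Eo \<union> arev ` Eo"
    proof
      show "arcs G \<subseteq> Eo \<union> arev ` Eo"
      proof
        fix e assume "e \<in> arcs G"
        then have "e \<in> Eo \<or> arev e \<in> Eo" using Eo by (auto simp: orientation_iff)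
        then show "e \<in> Eo \<union> arev ` Eo" by (metis UnCI arev_arev imageI)
      qed
    qed (use Eo in \<open>auto simp: orientation_iff\<close>)
    show "Eo \<inter> arev ` Eo = {}" using Eo by (auto simp: orientation_iff subset_iff)
  qed
  have "length p = (\<Sum>e\<in>arcs G. count_list p e)"
    using sum_count_set[OF p finite_arcs] by simp
  also have "\<dots> = (\<Sum>e\<in>Eo. count_list p e) + (\<Sum>e\<in>arev ` Eo. count_list p e)"
    using arcs fin by (simp add: sum.union_disjoint)
  also have "(\<Sum>e\<in>arev ` Eo. count_list p e) = (\<Sum>e\<in>Eo. count_list p (arev e))"
    by (subst sum.reindex) auto
  finally show ?thesis by (simp add: sum.distrib)
qed

text \<open>Adding up the equality of in- and out-degree over the vertices of
  \<open>S\<close>.\<close>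

lemma eulerian_orientation_cut:
  assumes Eo: "eulerian_orientation G arev Eo" and S: "S \<subseteq> verts G"
  shows "(\<Sum>e\<in>Eo. of_bool (tail G e \<in> S) - of_bool (head G e \<in> S)) = (0 :: int)"
proof -
  have fin: "finite Eo" using Eo finite_orientation by (auto simp: eulerian_orientation_def)
  have finS: "finite S" using S finite_verts finite_subset by blast
  have count: "(\<Sum>e\<in>Eo. of_bool (f e \<in> S)) = int (\<Sum>v\<in>S. card {e \<in> Eo. f e = v})" for f
  proof -
    have "(\<Sum>e\<in>Eo. of_bool (f e \<in> S)) = int (card {e \<in> Eo. f e \<in> S})"
      using fin by (simp add: of_bool_def sum.If_cases Int_def)
    also have "{e \<in> Eo. f e \<in> S} = (\<Union>v\<in>S. {e \<in> Eo. f e = v})" by auto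
    also have "card \<dots> = (\<Sum>v\<in>S. card {e \<in> Eo. f e = v})"
      using fin finS by (intro card_UN_disjoint) auto
    finally show ?thesis .
  qed
  have "(\<Sum>v\<in>S. card {e \<in> Eo. tail G e = v}) = (\<Sum>v\<in>S. card {e \<in> Eo. head G e = v})"
    using Eo S by (intro sum.cong) (auto simp: eulerian_orientation_def)
  then show ?thesis by (simp add: sum_subtractf count)
qed

text \<open>
  Balance across the cut given by the component of \<open>tail G e\<close> in \<open>T\<close> without \<open>e\<close>: the only edge of
  \<open>T\<close> that crosses it is \<open>e\<close>.
\<close>

lemma net_cong_1_on_tree:
  fixes n :: int
  assumes T: "is_spanning_tree G arev T" and Eo: "eulerian_orientation G arev Eo"
    and p: "closed_walk G p"
    and off: "\<And>e. e \<in> off_tree Eo T \<Longrightarrow> n dvd net p e - 1"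
    and e: "e \<in> Eo"
  shows "n dvd net p e - 1"
proof (cases "e \<in> \<Union>T")
  case False
  with e off show ?thesis by (simp add: off_tree_def)
next
  case True
  have or: "orientation G arev Eo" using Eo by (simp add: eulerian_orientation_def)
  have TE: "T \<subseteq> edges G arev" using T by (simp add: is_spanning_tree_def)
  let ?X = "T - {edge_of arev e}"
  have XE: "?X \<subseteq> edges G arev" using TE by auto
  interpret X: sym_digraph "G\<lparr>arcs := \<Union>?X\<rparr>" by (rule sym_digraph_edge_set[OF XE])
  define S where "S = {v. tail G e \<rightarrow>\<^sup>*\<^bsub>G\<lparr>arcs := \<Union>?X\<rparr>\<^esub> v}"
  \<comment> \<open>The signed crossing number: \<open>1\<close> for leaving \<open>S\<close>,
    \<open>-1\<close> for entering it, \<open>0\<close> otherwise.\<close>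
  define \<phi> :: "'e \<Rightarrow> int" where "\<phi> f = of_bool (tail G f \<in> S) - of_bool (head G f \<in> S)" for f
  have e_arc: "e \<in> arcs G" using or e by (auto simp: orientation_iff)
  have S: "S \<subseteq> verts G" by (auto simp: S_def dest: X.reachable_in_verts)
  have "tail G e \<in> S" using e_arc by (simp add: S_def X.reachable_refl)
  moreover have "head G e \<notin> S"
    using tree_edge_separates[OF T True] X.symmetric_reachable' by (auto simp: S_def)
  ultimately have \<phi>_e: "\<phi> e = 1" by (simp add: \<phi>_def)
  have \<phi>_tree: "\<phi> f = 0" if f: "f \<in> Eo" "f \<in> \<Union>T" "f \<noteq> e" for f
  proof -
    have "edge_of arev f \<noteq> edge_of arev e"
      using bij_betw_imp_inj_on[OF bij_betw_edge_of[OF or]] f e by (auto dest: inj_onD)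
    then have fX: "f \<in> \<Union>?X" using f(2) mem_edge_set_iff[OF TE] mem_edge_set_iff[OF XE] by simp
    then have "tail G f \<rightarrow>\<^bsub>G\<lparr>arcs := \<Union>?X\<rparr>\<^esub> head G f"
      using X.in_arcs_imp_in_arcs_ends[of f] by simp
    then have "tail G f \<rightarrow>\<^sup>*\<^bsub>G\<lparr>arcs := \<Union>?X\<rparr>\<^esub> head G f" by (rule X.reachable_adjI)
    then have "tail G f \<in> S \<longleftrightarrow> head G f \<in> S"
      unfolding S_def using X.symmetric_reachable' X.reachable_trans by blast
    then show ?thesis by (simp add: \<phi>_def)
  qed
  obtain u where u: "awalk u p u" using p by (auto simp: closed_walk_def)
  have "(\<Sum>f\<in>Eo. net p f * \<phi> f) = (\<Sum>f\<leftarrow>p. \<phi> f)"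
    using u by (intro sum_list_antisym[OF or, symmetric]) (auto simp: \<phi>_def awalk_def)
  also have "\<dots> = 0"
    unfolding \<phi>_def using u sum_list_cut_cas[of G u p u S] by (simp add: awalk_def)
  \<comment> \<open>Both the closed walk and the sum of all edges in \<open>Eo\<close> have balance
    zero across the cut, hence so does their difference.\<close>
  finally have "(\<Sum>f\<in>Eo. (net p f - 1) * \<phi> f) = 0"
    using eulerian_orientation_cut[OF Eo S] by (simp add: \<phi>_def left_diff_distrib sum_subtractf)
  moreover have "(\<Sum>f\<in>Eo. (net p f - 1) * \<phi> f) =
      (net p e - 1) + (\<Sum>f\<in>Eo - {e}. (net p f - 1) * \<phi> f)"
    using e finite_orientation[OF or] by (simp add: sum.remove \<phi>_e)
  \<comment> \<open>Off the tree the first factor is divisible by \<open>n\<close>; on the tree,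
    apart from \<open>e\<close>, the second factor is zero.\<close>
  moreover have "n dvd (\<Sum>f\<in>Eo - {e}. (net p f - 1) * \<phi> f)"
  proof (rule dvd_sum)
    fix f assume "f \<in> Eo - {e}"
    then show "n dvd (net p f - 1) * \<phi> f"
      using off \<phi>_tree by (cases "f \<in> \<Union>T") (auto simp: off_tree_def)
  qed
  ultimately show ?thesis by (metis dvd_0_right dvd_add_left_iff)
qed

lemma oriented_circuit_iff_net:
  assumes T: "is_spanning_tree G arev T" and Eo: "eulerian_orientation G arev Eo"
    and t: "t \<ge> 3" and p: "closed_walk G p" "length p = card (edges G arev)"
  shows "p \<in> oriented_circuits G arev Eo \<longleftrightarrow> (\<forall>e\<in>off_tree Eo T. int t dvd net p e - 1)"
proof
  have or: "orientation G arev Eo" using Eo by (simp add: eulerian_orientation_def)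
  have p_arcs: "set p \<subseteq> arcs G" using p(1) by (auto simp: closed_walk_def awalk_def)
  have sum1: "(\<Sum>e\<in>Eo. count_list p e + count_list p (arev e)) = card Eo"
    using length_eq_sum_count[OF or p_arcs] p(2) card_orientation[OF or] by simp
  {
    assume "p \<in> oriented_circuits G arev Eo"
    then have "distinct p" "set p = Eo" by (auto simp: oriented_circuits_eq[OF or])
    then have "net p e = 1" if "e \<in> Eo" for e
      using or that by (auto simp: net_def orientation_iff count_list_distinct subset_iff)
    then show "\<forall>e\<in>off_tree Eo T. int t dvd net p e - 1" by (simp add: off_tree_def)
  next
    assume "\<forall>e\<in>off_tree Eo T. int t dvd net p e - 1"
    then have dvd: "int t dvd net p e - 1" if "e \<in> Eo" for e
      using net_cong_1_on_tree[OF T Eo p(1)] that by blast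
    \<comment> \<open>An edge that is never traversed has net number \<open>0\<close>, which is not
      \<open>1\<close> modulo \<open>t\<close>.\<close>
    have pos: "count_list p e + count_list p (arev e) \<ge> 1" if "e \<in> Eo" for e
    proof (rule ccontr)
      assume "\<not> ?thesis"
      then have "net p e = 0" by (simp add: net_def)
      with dvd[OF that] t show False by simp
    qed
    \<comment> \<open>The \<open>m\<close> traversal numbers are at least \<open>1\<close> and add
      up to the length \<open>m\<close>, so none can exceed \<open>1\<close>.\<close>
    have one: "count_list p e + count_list p (arev e) = 1" if "e \<in> Eo" for e
    proof (rule ccontr)
      assume "\<not> ?thesis"
      with pos[OF that] have "1 < count_list p e + count_list p (arev e)" by simp
      with that have "\<exists>e\<in>Eo. 1 < count_list p e + count_list p (arev e)" by blast
      then have "(\<Sum>e\<in>Eo. 1) < (\<Sum>e\<in>Eo. count_list p e + count_list p (arev e))"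
        using pos finite_orientation[OF or] by (intro sum_strict_mono_ex1) simp_all
      with sum1 show False by simp
    qed
    \<comment> \<open>A single traversal in the negative direction would give net number
      \<open>-1\<close>, forcing \<open>t\<close> to divide \<open>2\<close>.\<close>
    have counts: "count_list p e = 1 \<and> count_list p (arev e) = 0" if "e \<in> Eo" for e
    proof (rule ccontr)
      assume "\<not> ?thesis"
      with one[OF that] have "net p e = -1" by (auto simp: net_def)
      with dvd[OF that] have "int t dvd 2" by simp
      then have "int t \<le> 2" by (rule zdvd_imp_le) simp
      with t show False by simp
    qed
    have "set p = Eo"
    proof
      show "Eo \<subseteq> set p"
      proof
        fix e assume "e \<in> Eo"
        then have "count_list p e \<noteq> 0" using counts by simp
        then show "e \<in> set p" by (simp add: count_list_0_iff)
      qed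
      show "set p \<subseteq> Eo"
      proof
        fix e assume e: "e \<in> set p"
        show "e \<in> Eo"
        proof (rule ccontr)
          assume "e \<notin> Eo"
          with e p_arcs or have "arev e \<in> Eo" by (auto simp: orientation_iff)
          then have "count_list p e = 0" using counts[of "arev e"] by simp
          with e show False by (simp add: count_list_0_iff)
        qed
      qed
    qed
    moreover have "distinct p"
      using \<open>set p = Eo\<close> p(2) card_orientation[OF or] by (intro card_distinct) simp
    ultimately show "p \<in> oriented_circuits G arev Eo"
      using p(1) by (simp add: oriented_circuits_eq[OF or])
  }
qed

section \<open>Averaging over chains\<close>

lemma lwalk_tail_head_iff:
  "set p \<subseteq> arcs G \<and> u \<in> verts G \<and> lwalk (tail G) (\<lambda>e v. head G e = v) u p v \<longleftrightarrow> awalk u p v"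
proof (induction p arbitrary: u)
  case (Cons e p)
  show ?case
    by (simp add: awalk_Cons_iff Cons.IH[symmetric]) (metis head_in_verts tail_in_verts)
qed (simp add: awalk_Nil_iff conj_commute)

text \<open>Forgetting that the walk does not backtrack. The label \<open>y\<close> is the edge that
  would follow \<open>p\<close>, so the walk ends at its tail.\<close>

lemma lwalk_feeds_into_awalk:
  assumes "set p \<subseteq> arcs G" "tail G x \<in> verts G" "lwalk (\<lambda>e. e) (feeds_into G arev) x p y"
  shows "awalk (tail G x) p (tail G y)"
  using assms
proof (induction p arbitrary: x)
  case (Cons e p)
  from Cons.prems(3) obtain z where z: "x = e" "feeds_into G arev e z"
    "lwalk (\<lambda>e. e) (feeds_into G arev) z p y" by auto
  then have "head G e = tail G z" by (simp add: feeds_into_def)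
  moreover have e: "e \<in> arcs G" "set p \<subseteq> arcs G" using Cons.prems(1) by auto
  ultimately have "awalk (head G e) p (tail G y)"
    using Cons.IH[OF e(2) _ z(3)] head_in_verts[OF e(1)] by simp
  with z e show ?case by (simp add: awalk_Cons_iff)
qed (auto simp: awalk_Nil_iff)

text \<open>A walk of positively oriented edges never backtracks.\<close>

lemma lwalk_feeds_intoI:
  assumes Eo: "orientation G arev Eo" and "awalk u p (tail G y)" "set p \<subseteq> Eo" "y \<in> Eo"
  shows "lwalk (\<lambda>e. e) (feeds_into G arev) (hd (p @ [y])) p y"
  using assms(2,3)
proof (induction p arbitrary: u)
  case (Cons e p)
  \<comment> \<open>The edge following \<open>e\<close>: the next one of the walk or, after the
    last, the closing label \<open>y\<close>.\<close>
  let ?z = "hd (p @ [y])"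
  have "?z \<in> Eo" using Cons.prems(2) \<open>y \<in> Eo\<close> by (cases p) auto
  moreover have "e \<in> Eo" "e \<in> arcs G" using Cons.prems by (auto simp: awalk_Cons_iff)
  ultimately have "?z \<noteq> arev e" using Eo by (auto simp: orientation_iff)
  moreover have "head G e = tail G ?z"
    using Cons.prems(1) by (cases p) (auto simp: awalk_Cons_iff awalk_Nil_iff)
  moreover have "lwalk (\<lambda>e. e) (feeds_into G arev) ?z p y"
    using Cons.prems by (intro Cons.IH[of "head G e"]) (auto simp: awalk_Cons_iff)
  ultimately have "feeds_into G arev e ?z \<and> lwalk (\<lambda>e. e) (feeds_into G arev) ?z p y"
    by (simp add: feeds_into_def)
  then show ?case by auto
qed simp

lemma mat_trace_adj_mat_pow:
  assumes "distinct vs" "set vs = verts G" "m > 0"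
  shows "mat_trace (adj_mat G arev Eo vs t c ^\<^sub>m m) =
    (\<Sum>p | closed_walk G p \<and> length p = m. prod_list (map (chi t arev Eo c) p))"
proof -
  have "tail G ` arcs G \<subseteq> set vs"
    unfolding assms(2) by (intro image_subsetI tail_in_verts)
  from mat_trace_pow_lwalk[OF assms(1) finite_arcs this assms(3),
      where Q = "\<lambda>e v. head G e = v" and w = "chi t arev Eo c"]
  have "mat_trace (adj_mat G arev Eo vs t c ^\<^sub>m m) =
      (\<Sum>p | length p = m \<and> set p \<subseteq> arcs G \<and>
        (\<exists>x\<in>set vs. lwalk (tail G) (\<lambda>e v. head G e = v) x p x). prod_list (map (chi t arev Eo c) p))"
    unfolding adj_mat_def .
  also have "{p. length p = m \<and> set p \<subseteq> arcs G \<and>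
        (\<exists>x\<in>set vs. lwalk (tail G) (\<lambda>e v. head G e = v) x p x)} = {p. closed_walk G p \<and> length p = m}"
  proof (intro Collect_cong)
    fix p
    have "set p \<subseteq> arcs G \<and> (\<exists>x\<in>set vs. lwalk (tail G) (\<lambda>e v. head G e = v) x p x) \<longleftrightarrow>
        (\<exists>u. awalk u p u)"
      unfolding lwalk_tail_head_iff[symmetric] assms(2) by blast
    moreover have "p \<noteq> []" if "length p = m" using that assms(3) by auto
    ultimately show "length p = m \<and> set p \<subseteq> arcs G \<and>
        (\<exists>x\<in>set vs. lwalk (tail G) (\<lambda>e v. head G e = v) x p x) \<longleftrightarrow>
        closed_walk G p \<and> length p = m"
      unfolding closed_walk_def by blast
  qed
  finally show ?thesis .
qed

text \<open>Starting and ending at the same label \<open>e\<close> also excludes backtracking from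
  the last edge to the first.\<close>

lemma mat_trace_edge_adj_mat_pow:
  assumes "distinct es" "set es = arcs G" "m > 0"
  shows "mat_trace (edge_adj_mat G arev Eo es t c ^\<^sub>m m) =
    (\<Sum>p | length p = m \<and> set p \<subseteq> arcs G \<and>
      (\<exists>e\<in>arcs G. lwalk (\<lambda>e. e) (feeds_into G arev) e p e). prod_list (map (chi t arev Eo c) p))"
proof -
  \<comment> \<open>Each entry is written as a sum over at most one edge, namely the row label, to
    fit the general scheme.\<close>
  have "(if feeds_into G arev (es ! i) (es ! j) then chi t arev Eo c (es ! i) else 0) =
      (\<Sum>e | e \<in> arcs G \<and> e = es ! i \<and> feeds_into G arev e (es ! j). chi t arev Eo c e)"
    if "i < length es" for i j
  proof -
    have "{e. e \<in> arcs G \<and> e = es ! i \<and> feeds_into G arev e (es ! j)} =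
        (if feeds_into G arev (es ! i) (es ! j) then {es ! i} else {})"
      using that assms(2) nth_mem by auto
    then show ?thesis by simp
  qed
  then have "edge_adj_mat G arev Eo es t c = mat (length es) (length es) (\<lambda>(i, j).
      \<Sum>e | e \<in> arcs G \<and> e = es ! i \<and> feeds_into G arev e (es ! j). chi t arev Eo c e)"
    unfolding edge_adj_mat_def by (intro cong_mat) auto
  moreover have "mat_trace (mat (length es) (length es) (\<lambda>(i, j).
      \<Sum>e | e \<in> arcs G \<and> e = es ! i \<and> feeds_into G arev e (es ! j). chi t arev Eo c e) ^\<^sub>m m) =
      (\<Sum>p | length p = m \<and> set p \<subseteq> arcs G \<and>
        (\<exists>e\<in>set es. lwalk (\<lambda>e. e) (feeds_into G arev) e p e). prod_list (map (chi t arev Eo c) p))"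
    using assms by (intro mat_trace_pow_lwalk) auto
  ultimately show ?thesis using assms(2) by simp
qed

section \<open>Characters along walks and their average\<close>

text \<open>The exponent is the extension of \<open>c\<close> to all oriented edges that changes
  sign under \<open>arev\<close>; \<open>t > 1\<close> ensures that \<open>1 mod int t\<close> is
  \<open>1\<close>.\<close>

lemma chi_eq:
  assumes Eo: "orientation G arev Eo" and e: "e \<in> arcs G" and t: "t > 1"
  shows "chi t arev Eo c e = root_eps t powi (if e \<in> Eo then c e else - c (arev e))"
proof -
  have fin: "finite Eo" by (rule finite_orientation[OF Eo])
  have pos: "t > 0" using t by simp
  show ?thesis
  proof (cases "e \<in> Eo")
    case True
    then have "(\<Sum>x\<in>Eo. c x * unit_chain t arev Eo e x) = (\<Sum>x\<in>Eo. if x = e then c x else 0)"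
      using t by (intro sum.cong) (auto simp: unit_chain_def)
    then show ?thesis
      using True fin by (simp add: chi_def pairing_def root_eps_powi_mod[OF pos])
  next
    case False
    then have arev: "arev e \<in> Eo" using Eo e by (simp add: orientation_iff)
    have "(\<Sum>x\<in>Eo. c x * unit_chain t arev Eo e x) = (\<Sum>x\<in>Eo. if x = arev e then c x * ((- 1) mod int t) else 0)"
      using False by (intro sum.cong) (auto simp: unit_chain_def)
    also have "\<dots> = c (arev e) * ((- 1) mod int t)" using fin arev by simp
    finally have "pairing t Eo c (unit_chain t arev Eo e) = (- c (arev e)) mod int t"
      by (simp only: pairing_def mod_mult_right_eq) simp
    then show ?thesis using False by (simp add: chi_def root_eps_powi_mod[OF pos])
  qed
qed

text \<open>The exponents add up along \<open>p\<close> and change sign under \<open>arev\<close>,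
  so the product depends only on the net traversal numbers, and on these only where \<open>c\<close>
  is supported.\<close>

lemma prod_list_chi:
  assumes Eo: "orientation G arev Eo" and p: "set p \<subseteq> arcs G" and t: "t > 1"
    and F: "F \<subseteq> Eo" and c: "c \<in> M t Eo F"
  shows "prod_list (map (chi t arev Eo c) p) = root_eps t powi (\<Sum>e\<in>F. c e * net p e)"
proof -
  let ?\<phi> = "\<lambda>e. if e \<in> Eo then c e else - c (arev e)"
  have "prod_list (map (chi t arev Eo c) p) = root_eps t powi (\<Sum>e\<leftarrow>p. ?\<phi> e)"
    using p by (induction p) (simp_all add: chi_eq[OF Eo _ t] power_int_add root_eps_nonzero)
  also have "(\<Sum>e\<leftarrow>p. ?\<phi> e) = (\<Sum>e\<in>Eo. net p e * ?\<phi> e)"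
    using Eo by (intro sum_list_antisym[OF Eo p]) (auto simp: orientation_iff)
  also have "\<dots> = (\<Sum>e\<in>F. c e * net p e)"
    using F c finite_orientation[OF Eo] by (intro sum.mono_neutral_cong_right) (auto simp: M_def)
  finally show ?thesis .
qed

text \<open>\<open>P\<close> is only bounded from both sides so that the result covers all closed
  walks as well as the non-backtracking ones: the average removes every walk that is not an oriented
  circuit.\<close>

lemma sum_M_prod_list_chi:
  assumes T: "is_spanning_tree G arev T" and Eo: "eulerian_orientation G arev Eo"
    and t: "t \<ge> 3"
    and P: "oriented_circuits G arev Eo \<subseteq> P"
      "P \<subseteq> {p. closed_walk G p \<and> length p = card (edges G arev)}"
  shows "(\<Sum>c\<in>M t Eo (off_tree Eo T). root_eps t powi (- coeff_sum t (off_tree Eo T) c) *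
      (\<Sum>p\<in>P. prod_list (map (chi t arev Eo c) p))) =
    of_nat t powi genus G arev * of_nat (card (oriented_circuits G arev Eo))"
proof -
  let ?F = "off_tree Eo T" and ?z = "root_eps t"
  have or: "orientation G arev Eo" using Eo by (simp add: eulerian_orientation_def)
  have F: "?F \<subseteq> Eo" by (auto simp: off_tree_def)
  have t': "t > 0" "t > 1" using t by simp_all
  have arcs: "set p \<subseteq> arcs G" if "p \<in> P" for p
    using that P(2) by (auto simp: closed_walk_def awalk_def)
  have "P \<subseteq> {p. set p \<subseteq> arcs G \<and> length p = card (edges G arev)}" using arcs P(2) by blast
  then have finP: "finite P" using finite_lists_length_eq[OF finite_arcs] finite_subset by blast
  \<comment> \<open>The factor with \<open>coeff_sum\<close> shifts every net number by
    \<open>-1\<close>, so that orthogonality selects the value \<open>1\<close> modulo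
    \<open>t\<close> instead of \<open>0\<close>.\<close>
  have weighted: "?z powi (- coeff_sum t ?F c) * prod_list (map (chi t arev Eo c) p) =
      ?z powi (\<Sum>e\<in>?F. c e * (net p e - 1))" if c: "c \<in> M t Eo ?F" and p: "p \<in> P" for c p
  proof -
    have "?z powi (- coeff_sum t ?F c) = ?z powi (- (\<Sum>e\<in>?F. c e))"
      by (simp add: coeff_sum_def power_int_minus root_eps_powi_mod[OF t'(1)])
    then show ?thesis
      by (simp add: prod_list_chi[OF or arcs[OF p] t'(2) F c] right_diff_distrib sum_subtractf
          flip: power_int_add[OF disjI1[OF root_eps_nonzero]])
  qed
  have "(\<Sum>c\<in>M t Eo ?F. ?z powi (- coeff_sum t ?F c) * (\<Sum>p\<in>P. prod_list (map (chi t arev Eo c) p))) =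
      (\<Sum>c\<in>M t Eo ?F. \<Sum>p\<in>P. ?z powi (\<Sum>e\<in>?F. c e * (net p e - 1)))"
    by (intro sum.cong refl) (simp add: sum_distrib_left weighted)
  also have "\<dots> = (\<Sum>p\<in>P. \<Sum>c\<in>M t Eo ?F. ?z powi (\<Sum>e\<in>?F. c e * (net p e - 1)))"
    by (rule sum.swap)
  also have "\<dots> = (\<Sum>p\<in>P. if p \<in> oriented_circuits G arev Eo then of_nat t ^ card ?F else 0)"
  proof (intro sum.cong refl)
    fix p assume "p \<in> P"
    with P(2) have "closed_walk G p" "length p = card (edges G arev)" by auto
    then show "(\<Sum>c\<in>M t Eo ?F. ?z powi (\<Sum>e\<in>?F. c e * (net p e - 1))) =
        (if p \<in> oriented_circuits G arev Eo then of_nat t ^ card ?F else 0)"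
      by (simp only: sum_M_root_eps_powi[OF t'(1) finite_orientation[OF or] F]
          oriented_circuit_iff_net[OF T Eo t])
  qed
  also have "\<dots> = of_nat t ^ card ?F * of_nat (card (oriented_circuits G arev Eo))"
    using finP P(1) by (simp add: sum.If_cases Int_absorb1 mult.commute)
  also have "of_nat t ^ card ?F = (of_nat t powi genus G arev :: complex)"
    by (simp flip: card_off_tree[OF T or])
  finally show ?thesis .
qed

end

theorem theorem4p4:
  fixes G :: "('v, 'e) pre_digraph"
    and arev :: "'e \<Rightarrow> 'e"
    and T :: "'e set set"
    and Eo :: "'e set"
    and vs :: "'v list"
    and es :: "'e list"
    and m t :: nat
    and g :: int
  assumes graph: "conn_multigraph G arev"
    and vertex_enum: "distinct vs" "set vs = verts G"
    and oriented_edge_enum: "distinct es" "set es = arcs G"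
    and m: "m = card (edges G arev)"
    and g: "g = genus G arev"
    and eulerian: "eulerian_graph G arev"
    and tree: "is_spanning_tree G arev T"
    and orient: "eulerian_orientation G arev Eo"
    and t: "t \<ge> 3"
  shows "of_nat (ec G arev Eo) =
           1 / (of_nat m * of_nat t powi g) *
             (\<Sum>\<gamma> \<in> M t Eo (off_tree Eo T).
                root_eps t powi (- coeff_sum t (off_tree Eo T) \<gamma>) *
                mat_trace (edge_adj_mat G arev Eo es t \<gamma> ^\<^sub>m m))
       \<and> 1 / (of_nat m * of_nat t powi g) *
             (\<Sum>\<gamma> \<in> M t Eo (off_tree Eo T).
                root_eps t powi (- coeff_sum t (off_tree Eo T) \<gamma>) *
                mat_trace (edge_adj_mat G arev Eo es t \<gamma> ^\<^sub>m m)) =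
           1 / (of_nat m * of_nat t powi g) *
             (\<Sum>\<gamma> \<in> M t Eo (off_tree Eo T).
                root_eps t powi (- coeff_sum t (off_tree Eo T) \<gamma>) *
                mat_trace (adj_mat G arev Eo vs t \<gamma> ^\<^sub>m m))"
proof -
  interpret conn_multigraph G arev by (rule graph)
  have or: "orientation G arev Eo" using orient by (simp add: eulerian_orientation_def)
  \<comment> \<open>An Eulerian circuit is a nonempty walk, which supplies an edge and makes the
    division by \<open>m\<close> legitimate.\<close>
  have ne: "edges G arev \<noteq> {}"
  proof -
    obtain p where "closed_walk G p" using eulerian by (auto simp: eulerian_graph_def eulerian_circuit_def)
    then obtain e where "e \<in> arcs G" by (cases p) (auto simp: closed_walk_def awalk_Cons_iff)
    then show ?thesis by (auto simp: edges_def)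
  qed
  then have m_pos: "m > 0" using m finite_edges by (simp add: card_gt_0_iff)
  \<comment> \<open>\<open>?W\<close> collects the walks behind the trace for
    \<open>edge_adj_mat\<close>, and \<open>?A\<close> those for \<open>adj_mat\<close>; both
    contain all oriented circuits.\<close>
  let ?W = "{p. length p = m \<and> set p \<subseteq> arcs G \<and> (\<exists>e\<in>arcs G. lwalk (\<lambda>e. e) (feeds_into G arev) e p e)}"
  let ?A = "{p. closed_walk G p \<and> length p = card (edges G arev)}"
  have W_A: "?W \<subseteq> ?A"
  proof
    fix p assume p: "p \<in> ?W"
    then obtain e where "e \<in> arcs G" "lwalk (\<lambda>e. e) (feeds_into G arev) e p e" by blast
    with p have "awalk (tail G e) p (tail G e)" by (intro lwalk_feeds_into_awalk) auto
    with p m_pos show "p \<in> ?A" by (auto simp: closed_walk_def m)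
  qed
  have OC_W: "oriented_circuits G arev Eo \<subseteq> ?W"
  proof
    fix p assume p: "p \<in> oriented_circuits G arev Eo"
    then have cw: "closed_walk G p" "distinct p" "set p = Eo" by (simp_all add: oriented_circuits_eq[OF or])
    then obtain u where u: "awalk u p u" "p \<noteq> []" by (auto simp: closed_walk_def)
    then have hd: "hd p \<in> Eo" "tail G (hd p) = u" using cw(3) by (cases p; auto simp: awalk_Cons_iff)+
    \<comment> \<open>Closing the circuit with its own first edge as the label makes it a cyclically
      non-backtracking walk.\<close>
    then have "lwalk (\<lambda>e. e) (feeds_into G arev) (hd (p @ [hd p])) p (hd p)"
      using u cw by (intro lwalk_feeds_intoI[OF or]) auto
    then have "lwalk (\<lambda>e. e) (feeds_into G arev) (hd p) p (hd p)" using u by simp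
    moreover have "length p = m" using cw m card_orientation[OF or] distinct_card by metis
    ultimately show "p \<in> ?W" using hd cw(3) or by (auto simp: orientation_iff)
  qed
  have norm: "1 / (of_nat m * of_nat t powi g) *
      (of_nat t powi genus G arev * of_nat (card (oriented_circuits G arev Eo))) =
      (of_nat (ec G arev Eo) :: complex)"
    using m_pos t by (simp add: card_oriented_circuits[OF or ne] m g)
  have "(\<Sum>\<gamma> \<in> M t Eo (off_tree Eo T). root_eps t powi (- coeff_sum t (off_tree Eo T) \<gamma>) *
        mat_trace (edge_adj_mat G arev Eo es t \<gamma> ^\<^sub>m m)) =
      of_nat t powi genus G arev * of_nat (card (oriented_circuits G arev Eo))"
    unfolding mat_trace_edge_adj_mat_pow[OF oriented_edge_enum m_pos]
    by (rule sum_M_prod_list_chi[OF tree orient t OC_W W_A])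
  moreover have "(\<Sum>\<gamma> \<in> M t Eo (off_tree Eo T). root_eps t powi (- coeff_sum t (off_tree Eo T) \<gamma>) *
        mat_trace (adj_mat G arev Eo vs t \<gamma> ^\<^sub>m m)) =
      of_nat t powi genus G arev * of_nat (card (oriented_circuits G arev Eo))"
    unfolding mat_trace_adj_mat_pow[OF vertex_enum m_pos] unfolding m
    by (rule sum_M_prod_list_chi[OF tree orient t subset_trans[OF OC_W W_A] subset_refl])
  ultimately show ?thesis using norm by simp
qed

end
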